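(* Let $n\ge1$, $\mathbf{a}=(a_1,\dots,a_n)$, $\mathbf{b}=(b_1,\dots,b_n)\in\mathbb{Z}_{\ge0}^n$, and assume $\kappa\in\mathbb{C}\setminus\Xi$. For $\nu\in\mathcal{N}_0(\mathbf{a},\mathbf{b})$ let $P^M_{\nu,\kappa}(T)\in\mathcal{P}_{\mathbf{a},\mathbf{b}}(\kappa)$ be defined by $$P^M_{\nu,\kappa}(T)=\Pi^{(\kappa)}_{\mathbf{a},\mathbf{b}}(T^\nu).$$ Then the polynomials $\{P^M_{\nu,\kappa}\}_{\nu\in\mathcal{N}_0(\mathbf{a},\mathbf{b})}$ form a basis of $\mathcal{P}_{\mathbf{a},\mathbf{b}}(\kappa)$ (called the monomial basis).
   Context: $T=(t_{ij})$ is an $n\times n$ matrix of independent variables, $\partial_{ij}=\partial/\partial t_{ij}$, $D_{ij}=D^{(\kappa)}_{ij}=\kappa\,\partial_{ij}+\sum_{k,l=1}^nt_{kl}\,\partial_{il}\partial_{kj}$. $\mathbb{C}[T]_{\mathbf{a},\mathbf{b}}$ is the space of $P\in\mathbb{C}[T]$ that are homogeneous of degree $a_i$ in the $i$-th row of $T$ and of degree $b_j$ in the $j$-th column of $T$ for all $i,j$. $\mathcal{P}_{\mathbf{a},\mathbf{b}}(\kappa)=\{P\in\mathbb{C}[T]_{\mathbf{a},\mathbf{b}}\mid D^{(\kappa)}_{ii}P=0\text{ for all }i\}$. $\mathcal{N}_0(\mathbf{a},\mathbf{b})$ is the set of $\nu\in M_n(\mathbb{Z}_{\ge0})$ with row sums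 $\mathbf{a}$, column sums $\mathbf{b}$ and $\nu_{ii}=0$ for all $i$; $T^\nu=\prod_{i,j}t_{ij}^{\nu_{ij}}$. $\Xi=\mathbb{Z}\cap\bigcup_{i=1}^n[\,2-(a_i+b_i),\ 1-\max\{a_i,b_i\}\,]$. $\Pi^{(\kappa)}_{\mathbf{a},\mathbf{b}}:\mathbb{C}[T]_{\mathbf{a},\mathbf{b}}\to\mathcal{P}_{\mathbf{a},\mathbf{b}}(\kappa)$ is the projection sending $P$ to the unique element of $\mathcal{P}_{\mathbf{a},\mathbf{b}}(\kappa)$ which is congruent to $P$ modulo the ideal $(t_{11},t_{22},\dots,t_{nn})$ of $\mathbb{C}[T]$. *)

theory Defs
  imports Complex_Main "HOL-Library.Poly_Mapping"
begin

text \<open>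
  The index set \<open>{1, \<dots>, n}\<close> is a finite type \<open>'n\<close> (types are nonempty, so
  \<open>n \<ge> 1\<close>); a subscript \<open>ij\<close> is a pair. As in the monoid algebra, an exponent vector is an element
  of \<open>'n \<times> 'n \<Rightarrow>\<^sub>0 nat\<close> and a polynomial is a finitely supported function from
  exponent vectors to coefficients; multiplication is the convolution product of
  \<^theory>\<open>HOL-Library.Poly_Mapping\<close>.
\<close>

type_synonym 'n expo = "('n \<times> 'n) \<Rightarrow>\<^sub>0 nat"
type_synonym 'n tpoly = "'n expo \<Rightarrow>\<^sub>0 complex"

definition tconst :: "complex \<Rightarrow> 'n tpoly" where
  "tconst c = Poly_Mapping.single 0 c"

definition tvar :: "'n \<Rightarrow> 'n \<Rightarrow> 'n tpoly" where
  "tvar i j = Poly_Mapping.single (Poly_Mapping.single (i, j) 1) 1"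

definition tscale :: "complex \<Rightarrow> 'n tpoly \<Rightarrow> 'n tpoly" where
  "tscale c P = tconst c * P"

global_interpretation tpoly: vector_space "tscale :: complex \<Rightarrow> 'n tpoly \<Rightarrow> 'n tpoly"
  by unfold_locales
    (simp_all add: tscale_def tconst_def distrib_left distrib_right single_add mult_single
      flip: mult.assoc)

global_interpretation tpoly_ring: module "(*) :: 'n tpoly \<Rightarrow> 'n tpoly \<Rightarrow> 'n tpoly"
  by unfold_locales (simp_all add: algebra_simps)

text \<open>
  In \<open>pderiv_t\<close> the subtraction of exponents is truncated, but the terms where it truncates
  carry the factor \<open>0\<close>.
\<close>

definition pderiv_t :: "'n \<Rightarrow> 'n \<Rightarrow> 'n tpoly \<Rightarrow> 'n tpoly" where
  "pderiv_t i j P = (\<Sum>m\<in>Poly_Mapping.keys P.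
     Poly_Mapping.single (m - Poly_Mapping.single (i, j) 1)
       (of_nat (Poly_Mapping.lookup m (i, j)) * Poly_Mapping.lookup P m))"

definition D_op :: "complex \<Rightarrow> 'n::finite \<Rightarrow> 'n \<Rightarrow> 'n tpoly \<Rightarrow> 'n tpoly" where
  "D_op \<kappa> i j P = tscale \<kappa> (pderiv_t i j P)
     + (\<Sum>k\<in>UNIV. \<Sum>l\<in>UNIV. tvar k l * pderiv_t i l (pderiv_t k j P))"

definition multihom :: "('n::finite \<Rightarrow> nat) \<Rightarrow> ('n \<Rightarrow> nat) \<Rightarrow> 'n tpoly set" where
  "multihom a b = {P. \<forall>m\<in>Poly_Mapping.keys P.
     (\<forall>i. (\<Sum>j\<in>UNIV. Poly_Mapping.lookup m (i, j)) = a i) \<and>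
     (\<forall>j. (\<Sum>i\<in>UNIV. Poly_Mapping.lookup m (i, j)) = b j)}"

definition P_space :: "('n::finite \<Rightarrow> nat) \<Rightarrow> ('n \<Rightarrow> nat) \<Rightarrow> complex \<Rightarrow> 'n tpoly set" where
  "P_space a b \<kappa> = {P \<in> multihom a b. \<forall>i. D_op \<kappa> i i P = 0}"

definition N0 :: "('n::finite \<Rightarrow> nat) \<Rightarrow> ('n \<Rightarrow> nat) \<Rightarrow> ('n \<Rightarrow> 'n \<Rightarrow> nat) set" where
  "N0 a b = {\<nu>. (\<forall>i. (\<Sum>j\<in>UNIV. \<nu> i j) = a i) \<and> (\<forall>j. (\<Sum>i\<in>UNIV. \<nu> i j) = b j)
     \<and> (\<forall>i. \<nu> i i = 0)}"

definition tmonom :: "('n::finite \<Rightarrow> 'n \<Rightarrow> nat) \<Rightarrow> 'n tpoly" where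
  "tmonom \<nu> = (\<Prod>i\<in>UNIV. \<Prod>j\<in>UNIV. tvar i j ^ \<nu> i j)"

definition Xi :: "('n::finite \<Rightarrow> nat) \<Rightarrow> ('n \<Rightarrow> nat) \<Rightarrow> int set" where
  "Xi a b = (\<Union>i. {2 - (int (a i) + int (b i)) .. 1 - int (max (a i) (b i))})"

text \<open>The ideal \<open>(t\<^sub>1\<^sub>1, \<dots>, t\<^sub>n\<^sub>n)\<close>, as the span in the polynomial ring
  regarded as a module over itself.\<close>

definition diag_ideal :: "'n tpoly set" where
  "diag_ideal = tpoly_ring.span (range (\<lambda>i. tvar i i))"

definition Pi_proj ::
    "('n::finite \<Rightarrow> nat) \<Rightarrow> ('n \<Rightarrow> nat) \<Rightarrow> complex \<Rightarrow> 'n tpoly \<Rightarrow> 'n tpoly" where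
  "Pi_proj a b \<kappa> P = (THE Q. Q \<in> P_space a b \<kappa> \<and> Q - P \<in> diag_ideal)"

definition P_M ::
    "('n::finite \<Rightarrow> nat) \<Rightarrow> ('n \<Rightarrow> nat) \<Rightarrow> complex \<Rightarrow> ('n \<Rightarrow> 'n \<Rightarrow> nat) \<Rightarrow> 'n tpoly" where
  "P_M a b \<kappa> \<nu> = Pi_proj a b \<kappa> (tmonom \<nu>)"

text \<open>A family (not merely its image set) being a basis of a subspace \<open>V\<close>; the span condition
  includes that all members lie in \<open>V\<close>.\<close>

definition basis_family :: "('i \<Rightarrow> 'n tpoly) \<Rightarrow> 'i set \<Rightarrow> 'n tpoly set \<Rightarrow> bool" where
  "basis_family f I V \<longleftrightarrow>
     inj_on f I \<and> tpoly.independent (f ` I) \<and> tpoly.span (f ` I) = V"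

end

theory Submission
  imports Defs "HOL-Library.FuncSet"
begin

text \<open>
  On multihomogeneous polynomials of degree \<open>(a, b)\<close> the equation \<open>D\<^sub>i\<^sub>i P = 0\<close> is a recursion in the
  exponent \<open>r\<close> of \<open>t\<^sub>i\<^sub>i\<close>: it multiplies the coefficients with exponent \<open>r + 1\<close> by
  \<open>(\<kappa> + a\<^sub>i + b\<^sub>i - 2 - r) (r + 1)\<close> and determines them from those with exponent \<open>r\<close>. The condition
  \<open>\<kappa> \<notin> \<Xi>\<close> says that these factors do not vanish for \<open>r < min a\<^sub>i b\<^sub>i\<close>. Hence a polynomial free of
  \<open>t\<^sub>i\<^sub>i\<close> extends uniquely to a solution of the \<open>i\<close>-th equation; as the operators \<open>D\<^sub>i\<^sub>i\<close>
  commute, the extensions for all \<open>i\<close> are compatible. So reduction modulo the diagonal variables is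
  an isomorphism from the solution space onto the span of the monomials \<open>T\<^sup>\<nu>\<close> with zero diagonal.
\<close>

section \<open>Coefficients of products and partial derivatives\<close>

abbreviation "lookup \<equiv> Poly_Mapping.lookup"

abbreviation unit_expo :: "'n \<Rightarrow> 'n \<Rightarrow> 'n expo" where
  "unit_expo i j \<equiv> Poly_Mapping.single (i, j) 1"

lemma lookup_single_times:
  "lookup (Poly_Mapping.single s c * P) m = c * Sum_any (\<lambda>q. lookup P q when m = s + q)"
proof -
  have "lookup (Poly_Mapping.single s c * P) m
      = Sum_any (\<lambda>l. (c when s = l) * Sum_any (\<lambda>q. lookup P q when m = l + q))"
    by (simp add: lookup_mult lookup_single)
  also have "\<dots> = Sum_any (\<lambda>l. (c * Sum_any (\<lambda>q. lookup P q when m = l + q)) when s = l)"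
    by (simp add: when_mult)
  finally show ?thesis by simp
qed

lemma lookup_tscale: "lookup (tscale c P) m = c * lookup P m"
  by (simp add: tscale_def tconst_def lookup_single_times)

lemma minus_unit_expo_add:
  assumes "lookup m (i, j) > 0"
  shows "m - unit_expo i j + unit_expo i j = (m :: 'n expo)"
  by (rule poly_mapping_eqI) (use assms in \<open>auto simp: lookup_add lookup_minus lookup_single when_def\<close>)

lemma lookup_tvar_times:
  "lookup (tvar k l * P) m = (if lookup m (k, l) > 0 then lookup P (m - unit_expo k l) else 0)"
proof (cases "lookup m (k, l) > 0")
  case True
  then have "m = unit_expo k l + q \<longleftrightarrow> q = m - unit_expo k l" for q
    using minus_unit_expo_add[of m k l] by (auto simp: add.commute)
  then show ?thesis
    using True by (simp add: tvar_def lookup_single_times)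
next
  case False
  then have "m \<noteq> unit_expo k l + q" for q
    by (auto simp: lookup_add)
  then show ?thesis
    using False by (simp add: tvar_def lookup_single_times)
qed

text \<open>Lowering the exponent at \<open>(i, j)\<close> is injective on exponents that are
  positive there, and the others carry the factor 0. So only \<open>m + unit_expo i j\<close>
  contributes at \<open>m\<close>.\<close>

lemma lookup_pderiv_t:
  "lookup (pderiv_t i j P) m
     = of_nat (Suc (lookup m (i, j))) * lookup P (m + unit_expo i j)"
proof -
  let ?c = "\<lambda>q. of_nat (lookup q (i, j)) * lookup P q"
  have "lookup (pderiv_t i j P) m
      = (\<Sum>q\<in>Poly_Mapping.keys P. if q - unit_expo i j = m then ?c q else 0)"
    by (simp add: pderiv_t_def lookup_sum lookup_single when_def)
  also have "\<dots> = (\<Sum>q\<in>Poly_Mapping.keys P. if q = m + unit_expo i j then ?c q else 0)"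
  proof (rule sum.cong)
    fix q
    show "(if q - unit_expo i j = m then ?c q else 0) = (if q = m + unit_expo i j then ?c q else 0)"
      using minus_unit_expo_add[of q i j] by (cases "lookup q (i, j) > 0") auto
  qed simp
  also have "\<dots> = ?c (m + unit_expo i j)"
    by (auto simp: in_keys_iff)
  finally show ?thesis
    by (simp add: lookup_add)
qed

lemma pderiv_t_add: "pderiv_t i j (P + Q) = pderiv_t i j P + pderiv_t i j Q"
  by (rule poly_mapping_eqI) (simp add: lookup_pderiv_t lookup_add ring_distribs)

lemma pderiv_t_zero [simp]: "pderiv_t i j 0 = 0"
  by (rule poly_mapping_eqI) (simp add: lookup_pderiv_t)

lemma pderiv_t_sum: "pderiv_t i j (\<Sum>x\<in>A. f x) = (\<Sum>x\<in>A. pderiv_t i j (f x))"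
  by (induction A rule: infinite_finite_induct) (simp_all add: pderiv_t_add)

lemma pderiv_t_tscale: "pderiv_t i j (tscale c P) = tscale c (pderiv_t i j P)"
  by (rule poly_mapping_eqI) (simp add: lookup_pderiv_t lookup_tscale)

lemma pderiv_t_commute: "pderiv_t i j (pderiv_t k l P) = pderiv_t k l (pderiv_t i j P)"
  by (rule poly_mapping_eqI) (simp add: lookup_pderiv_t lookup_add lookup_single when_def add_ac)

lemma lookup_tvar_times_pderiv_t:
  "lookup (tvar k l * pderiv_t k l P) m = of_nat (lookup m (k, l)) * lookup P m"
proof (cases "lookup m (k, l) > 0")
  case True
  then show ?thesis
    by (simp add: lookup_tvar_times lookup_pderiv_t lookup_minus
      minus_unit_expo_add[OF True, unfolded One_nat_def] of_nat_diff)
qed (simp add: lookup_tvar_times)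

text \<open>The Weyl algebra relation between variables and derivatives, from which the composed
  operators are computed.\<close>

lemma pderiv_t_tvar_times:
  "pderiv_t i j (tvar k l * P)
     = (if (i, j) = (k, l) then P else 0) + tvar k l * pderiv_t i j P"
proof (cases "(i, j) = (k, l)")
  case True
  show ?thesis
  proof (rule poly_mapping_eqI)
    fix m
    have "lookup (pderiv_t k l (tvar k l * P)) m = of_nat (Suc (lookup m (k, l))) * lookup P m"
      by (simp add: lookup_pderiv_t lookup_tvar_times lookup_add)
    then show "lookup (pderiv_t i j (tvar k l * P)) m
        = lookup ((if (i, j) = (k, l) then P else 0) + tvar k l * pderiv_t i j P) m"
      using True by (simp add: lookup_add lookup_tvar_times_pderiv_t distrib_right)
  qed
next
  case False
  have comm: "m + unit_expo i j - unit_expo k l = m - unit_expo k l + unit_expo i j" for m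
    by (rule poly_mapping_eqI)
      (use False in \<open>auto simp: lookup_add lookup_minus lookup_single when_def\<close>)
  show ?thesis
    by (rule poly_mapping_eqI)
      (use False in \<open>auto simp: lookup_pderiv_t lookup_tvar_times lookup_add lookup_minus
        lookup_single when_def comm[unfolded One_nat_def]\<close>)
qed

section \<open>Commutativity of the operators \<open>D_op \<kappa> i i\<close>\<close>

lemma tscale_add_right: "tscale c (P + Q) = tscale c P + tscale c Q"
  by (simp add: tscale_def distrib_left)

lemma tscale_times: "tscale c (P * Q) = P * tscale c Q"
  unfolding tscale_def by (rule mult.left_commute)

lemma tscale_sum: "tscale c (\<Sum>x\<in>A. f x) = (\<Sum>x\<in>A. tscale c (f x))"
  by (simp add: tscale_def sum_distrib_left)

text \<open>With a single sum over pairs, one Kronecker delta collapses at once, and one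
  \<open>sum.swap\<close> exchanges two double sums.\<close>

lemma sum_UNIV_UNIV:
  fixes f :: "'a::finite \<Rightarrow> 'b::finite \<Rightarrow> 'c::comm_monoid_add"
  shows "(\<Sum>k\<in>UNIV. \<Sum>l\<in>UNIV. f k l) = (\<Sum>x\<in>UNIV. f (fst x) (snd x))"
  by (simp add: sum.cartesian_product case_prod_unfold)

lemma sum_UNIV_quadruple_swap:
  fixes f :: "'a::finite \<Rightarrow> 'b::finite \<Rightarrow> 'a \<Rightarrow> 'b \<Rightarrow> 'c::comm_monoid_add"
  shows "(\<Sum>k\<in>UNIV. \<Sum>l\<in>UNIV. \<Sum>k'\<in>UNIV. \<Sum>l'\<in>UNIV. f k l k' l')
    = (\<Sum>k\<in>UNIV. \<Sum>l\<in>UNIV. \<Sum>k'\<in>UNIV. \<Sum>l'\<in>UNIV. f k' l' k l)"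
proof -
  have pairs: "(\<Sum>k\<in>UNIV. \<Sum>l\<in>UNIV. \<Sum>k'\<in>UNIV. \<Sum>l'\<in>UNIV. g k l k' l')
      = (\<Sum>x\<in>UNIV. \<Sum>y\<in>UNIV. g (fst x) (snd x) (fst y) (snd y))"
    for g :: "'a \<Rightarrow> 'b \<Rightarrow> 'a \<Rightarrow> 'b \<Rightarrow> 'c"
  proof -
    have "(\<Sum>k'\<in>UNIV. \<Sum>l'\<in>UNIV. g k l k' l') = (\<Sum>y\<in>UNIV. g k l (fst y) (snd y))" for k l
      by (rule sum_UNIV_UNIV)
    then show ?thesis
      by (simp only: sum_UNIV_UNIV[of "\<lambda>k l. \<Sum>y\<in>UNIV. g k l (fst y) (snd y)"])
  qed
  show ?thesis
    unfolding pairs by (rule sum.swap)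
qed

lemma pderiv_t_sum_tvar_times:
  fixes F :: "'n::finite \<Rightarrow> 'n \<Rightarrow> 'n tpoly"
  shows "pderiv_t p q (\<Sum>k\<in>UNIV. \<Sum>l\<in>UNIV. tvar k l * F k l)
    = F p q + (\<Sum>k\<in>UNIV. \<Sum>l\<in>UNIV. tvar k l * pderiv_t p q (F k l))"
proof -
  have "(\<Sum>k\<in>UNIV. \<Sum>l\<in>UNIV. if (p, q) = (k, l) then F k l else 0) = F p q"
  proof -
    have "(\<Sum>k\<in>UNIV. \<Sum>l\<in>UNIV. if (p, q) = (k, l) then F k l else 0)
      = (\<Sum>x\<in>UNIV. if (p, q) = (fst x, snd x) then F (fst x) (snd x) else 0)"
      by (rule sum_UNIV_UNIV)
    also have "\<dots> = F p q" by (simp only: prod.collapse) simp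
    finally show ?thesis .
  qed
  then show ?thesis
    by (simp add: pderiv_t_sum pderiv_t_tvar_times sum.distrib)
qed

text \<open>The middle summand arises when the derivative hits the factor \<open>tvar p q\<close> of
  the quadratic part.\<close>

lemma pderiv_t_D_op:
  "pderiv_t p q (D_op \<kappa> j j P)
     = tscale \<kappa> (pderiv_t p q (pderiv_t j j P)) + pderiv_t j q (pderiv_t p j P)
       + (\<Sum>k\<in>UNIV. \<Sum>l\<in>UNIV. tvar k l * pderiv_t p q (pderiv_t j l (pderiv_t k j P)))"
  by (simp add: D_op_def pderiv_t_add pderiv_t_tscale pderiv_t_sum_tvar_times add.assoc)

lemma pderiv_t_pderiv_t_D_op:
  "pderiv_t r s (pderiv_t p q (D_op \<kappa> j j P))
     = tscale \<kappa> (pderiv_t r s (pderiv_t p q (pderiv_t j j P)))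
       + pderiv_t r s (pderiv_t j q (pderiv_t p j P))
       + pderiv_t p q (pderiv_t j s (pderiv_t r j P))
       + (\<Sum>k\<in>UNIV. \<Sum>l\<in>UNIV.
            tvar k l * pderiv_t r s (pderiv_t p q (pderiv_t j l (pderiv_t k j P))))"
  unfolding pderiv_t_D_op
  by (simp add: pderiv_t_add pderiv_t_tscale pderiv_t_sum_tvar_times add.assoc)

text \<open>Normal ordering: all variables stand to the left of all derivatives. The third-order
  terms are grouped in pairs whose members are interchanged by swapping \<open>i\<close> and
  \<open>j\<close>, up to the order of the derivatives.\<close>

lemma D_op_D_op:
  fixes P :: "'n::finite tpoly"
  shows "D_op \<kappa> i i (D_op \<kappa> j j P)
     = tscale \<kappa> (tscale \<kappa> (pderiv_t i i (pderiv_t j j P)))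
       + tscale \<kappa> (pderiv_t j i (pderiv_t i j P))
       + ((\<Sum>k\<in>UNIV. \<Sum>l\<in>UNIV. tvar k l * tscale \<kappa> (pderiv_t i i (pderiv_t j l (pderiv_t k j P))))
          + (\<Sum>k\<in>UNIV. \<Sum>l\<in>UNIV. tvar k l * tscale \<kappa> (pderiv_t j j (pderiv_t i l (pderiv_t k i P)))))
       + ((\<Sum>k\<in>UNIV. \<Sum>l\<in>UNIV. tvar k l * pderiv_t i j (pderiv_t j l (pderiv_t k i P)))
          + (\<Sum>k\<in>UNIV. \<Sum>l\<in>UNIV. tvar k l * pderiv_t j i (pderiv_t i l (pderiv_t k j P))))
       + (\<Sum>k\<in>UNIV. \<Sum>l\<in>UNIV. \<Sum>k'\<in>UNIV. \<Sum>l'\<in>UNIV.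
            tvar k l * (tvar k' l' * pderiv_t i l (pderiv_t k i (pderiv_t j l' (pderiv_t k' j P)))))"
proof -
  have "D_op \<kappa> i i (D_op \<kappa> j j P) = tscale \<kappa> (pderiv_t i i (D_op \<kappa> j j P))
     + (\<Sum>k\<in>UNIV. \<Sum>l\<in>UNIV. tvar k l * pderiv_t i l (pderiv_t k i (D_op \<kappa> j j P)))"
    by (simp add: D_op_def[of \<kappa> i i "D_op \<kappa> j j P"])
  moreover have "tscale \<kappa> (pderiv_t i i (D_op \<kappa> j j P))
    = tscale \<kappa> (tscale \<kappa> (pderiv_t i i (pderiv_t j j P)))
       + tscale \<kappa> (pderiv_t j i (pderiv_t i j P))
       + (\<Sum>k\<in>UNIV. \<Sum>l\<in>UNIV. tvar k l * tscale \<kappa> (pderiv_t i i (pderiv_t j l (pderiv_t k j P))))"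
    by (simp add: pderiv_t_D_op tscale_add_right tscale_sum tscale_times)
  moreover have "tvar k l * pderiv_t i l (pderiv_t k i (D_op \<kappa> j j P))
    = tvar k l * tscale \<kappa> (pderiv_t j j (pderiv_t i l (pderiv_t k i P)))
      + tvar k l * pderiv_t j i (pderiv_t i l (pderiv_t k j P))
      + tvar k l * pderiv_t i j (pderiv_t j l (pderiv_t k i P))
      + (\<Sum>k'\<in>UNIV. \<Sum>l'\<in>UNIV.
            tvar k l * (tvar k' l' * pderiv_t i l (pderiv_t k i (pderiv_t j l' (pderiv_t k' j P)))))" for k l
  proof -
    have "pderiv_t i l (pderiv_t k i (pderiv_t j j P)) = pderiv_t j j (pderiv_t i l (pderiv_t k i P))"
      "pderiv_t i l (pderiv_t j i (pderiv_t k j P)) = pderiv_t j i (pderiv_t i l (pderiv_t k j P))"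
      "pderiv_t k i (pderiv_t j l (pderiv_t i j P)) = pderiv_t i j (pderiv_t j l (pderiv_t k i P))"
      by (metis pderiv_t_commute)+
    then show ?thesis
      by (simp add: pderiv_t_pderiv_t_D_op distrib_left sum_distrib_left)
  qed
  ultimately show ?thesis
    by (simp add: sum.distrib add_ac)
qed

lemma D_op_commute:
  fixes P :: "'n::finite tpoly"
  shows "D_op \<kappa> i i (D_op \<kappa> j j P) = D_op \<kappa> j j (D_op \<kappa> i i P)"
proof -
  let ?G = "\<lambda>i j k l k' l'. tvar k l *
    (tvar k' l' * pderiv_t i l (pderiv_t k i (pderiv_t j l' (pderiv_t k' j P))))"
  have "?G i j k l k' l' = ?G j i k' l' k l" for k l k' l'
  proof -
    have "pderiv_t i l (pderiv_t k i (pderiv_t j l' (pderiv_t k' j P)))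
        = pderiv_t j l' (pderiv_t k' j (pderiv_t i l (pderiv_t k i P)))"
      by (metis pderiv_t_commute)
    then show ?thesis by (simp only: mult.left_commute)
  qed
  then have "(\<Sum>k\<in>UNIV. \<Sum>l\<in>UNIV. \<Sum>k'\<in>UNIV. \<Sum>l'\<in>UNIV. ?G i j k l k' l')
      = (\<Sum>k\<in>UNIV. \<Sum>l\<in>UNIV. \<Sum>k'\<in>UNIV. \<Sum>l'\<in>UNIV. ?G j i k' l' k l)"
    by (intro sum.cong refl)
  \<comment> \<open>Exchanging the summation indices \<open>(k, l)\<close> and
    \<open>(k', l')\<close> shows that the fourth-order sum is symmetric in \<open>i\<close> and
    \<open>j\<close>.\<close>
  then have quad: "(\<Sum>k\<in>UNIV. \<Sum>l\<in>UNIV. \<Sum>k'\<in>UNIV. \<Sum>l'\<in>UNIV. ?G i j k l k' l')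
      = (\<Sum>k\<in>UNIV. \<Sum>l\<in>UNIV. \<Sum>k'\<in>UNIV. \<Sum>l'\<in>UNIV. ?G j i k l k' l')"
    by (simp only: sum_UNIV_quadruple_swap[of "?G j i"])
  show ?thesis
    unfolding D_op_D_op quad
    by (simp add: pderiv_t_commute[of i i j j] pderiv_t_commute[of j i i j] add_ac)
qed

section \<open>The operators in terms of coefficients and degrees\<close>

text \<open>The part of \<open>D_op \<kappa> i i\<close> that preserves the exponent of the
  \<open>i\<close>-th diagonal variable. All other terms contain \<open>pderiv_t i i\<close> and
  lower that exponent by one.\<close>

definition L_op :: "'n::finite \<Rightarrow> 'n tpoly \<Rightarrow> 'n tpoly" where
  "L_op i P = (\<Sum>k\<in>-{i}. \<Sum>l\<in>-{i}. tvar k l * pderiv_t i l (pderiv_t k i P))"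

definition has_degrees :: "('n::finite \<Rightarrow> nat) \<Rightarrow> ('n \<Rightarrow> nat) \<Rightarrow> 'n expo \<Rightarrow> bool" where
  "has_degrees a b m \<longleftrightarrow> (\<forall>i. (\<Sum>j\<in>UNIV. lookup m (i, j)) = a i) \<and>
     (\<forall>j. (\<Sum>i\<in>UNIV. lookup m (i, j)) = b j)"

lemma multihom_iff: "P \<in> multihom a b \<longleftrightarrow> (\<forall>m. lookup P m \<noteq> 0 \<longrightarrow> has_degrees a b m)"
  by (auto simp: multihom_def has_degrees_def in_keys_iff)

text \<open>On a multihomogeneous space the terms of \<^term>\<open>D_op \<kappa> i i\<close> with \<open>k = i\<close> or \<open>l = i\<close> are
  Euler operators applied to the derivative by the \<open>i\<close>-th diagonal variable, hence act on it as scalars.\<close>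

lemma lookup_D_op:
  fixes P :: "'n::finite tpoly"
  assumes P: "P \<in> multihom a b"
  shows "lookup (D_op \<kappa> i i P) m
    = (\<kappa> + of_nat (a i) + of_nat (b i) - 2 - of_nat (lookup m (i, i))) * of_nat (Suc (lookup m (i, i)))
        * lookup P (m + unit_expo i i) + lookup (L_op i P) m"
proof -
  let ?c = "lookup (pderiv_t i i P) m"
  let ?T = "\<lambda>k l. lookup (tvar k l * pderiv_t i l (pderiv_t k i P)) m"
  have row: "?T i l = of_nat (lookup m (i, l)) * ?c" for l
    by (simp add: lookup_tvar_times_pderiv_t)
  have col: "?T k i = of_nat (lookup m (k, i)) * ?c" for k
    by (simp add: pderiv_t_commute[of i i k i] lookup_tvar_times_pderiv_t)
  have "lookup (D_op \<kappa> i i P) m = \<kappa> * ?c + (\<Sum>k\<in>UNIV. \<Sum>l\<in>UNIV. ?T k l)"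
    by (simp add: D_op_def lookup_add lookup_tscale lookup_sum)
  \<comment> \<open>The double sum splits into row \<open>i\<close>, the rest of column
    \<open>i\<close>, and \<open>L_op\<close>. The diagonal term is counted with the row
    only.\<close>
  also have "(\<Sum>k\<in>UNIV. \<Sum>l\<in>UNIV. ?T k l) = (\<Sum>l\<in>UNIV. ?T i l) + (\<Sum>k\<in>-{i}. \<Sum>l\<in>UNIV. ?T k l)"
    by (simp add: sum.remove[of UNIV i] Compl_eq_Diff_UNIV)
  also have "(\<Sum>k\<in>-{i}. \<Sum>l\<in>UNIV. ?T k l) = (\<Sum>k\<in>-{i}. ?T k i) + (\<Sum>k\<in>-{i}. \<Sum>l\<in>-{i}. ?T k l)"
    by (simp add: sum.remove[of UNIV i "\<lambda>l. ?T _ l"] Compl_eq_Diff_UNIV sum.distrib)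
  also have "(\<Sum>k\<in>-{i}. \<Sum>l\<in>-{i}. ?T k l) = lookup (L_op i P) m"
    by (simp add: L_op_def lookup_sum)
  also have "(\<Sum>l\<in>UNIV. ?T i l) = of_nat (\<Sum>l\<in>UNIV. lookup m (i, l)) * ?c"
    by (simp only: row of_nat_sum sum_distrib_right)
  also have "(\<Sum>k\<in>-{i}. ?T k i) = of_nat (\<Sum>k\<in>-{i}. lookup m (k, i)) * ?c"
    by (simp only: col of_nat_sum sum_distrib_right)
  finally have main: "lookup (D_op \<kappa> i i P) m = (\<kappa> + of_nat (\<Sum>l\<in>UNIV. lookup m (i, l))
      + of_nat (\<Sum>k\<in>-{i}. lookup m (k, i))) * ?c + lookup (L_op i P) m"
    by (simp add: algebra_simps)
  \<comment> \<open>The degrees of \<open>m\<close> are known only if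
    \<open>m + unit_expo i i\<close> occurs in \<open>P\<close>; otherwise the scalar multiplies 0
    on both sides. In the first case row and column each lose 1, and the column also loses the
    diagonal exponent, which gives the scalar of the statement.\<close>
  show ?thesis
  proof (cases "lookup P (m + unit_expo i i) = 0")
    case True
    then show ?thesis using main by (simp add: lookup_pderiv_t)
  next
    case False
    then have deg: "has_degrees a b (m + unit_expo i i)"
      using P by (simp add: multihom_iff)
    have "a i = (\<Sum>l\<in>UNIV. lookup (m + unit_expo i i) (i, l))"
      "b i = (\<Sum>k\<in>UNIV. lookup (m + unit_expo i i) (k, i))"
      using deg by (simp_all add: has_degrees_def)
    then have r: "a i = (\<Sum>l\<in>UNIV. lookup m (i, l)) + 1"
      and "b i = (\<Sum>k\<in>UNIV. lookup m (k, i)) + 1"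
      by (simp_all add: lookup_add lookup_single when_def sum.distrib)
    then have c: "b i = (\<Sum>k\<in>-{i}. lookup m (k, i)) + lookup m (i, i) + 1"
      by (simp add: sum.remove[of UNIV i "\<lambda>k. lookup m (k, i)"] Compl_eq_Diff_UNIV)
    show ?thesis
      unfolding main r c by (simp add: lookup_pderiv_t algebra_simps)
  qed
qed

text \<open>For \<open>k\<close> and \<open>l\<close> different from \<open>i\<close>, the
  coefficient at \<open>m\<close> is read from
  \<open>m - unit_expo k l + unit_expo i l + unit_expo k i\<close>. Both added units are off the
  diagonal, and the removed one is not at \<open>(i, i)\<close>.\<close>

lemma lookup_L_op_cong:
  fixes P Q :: "'n::finite tpoly"
  assumes "\<And>q. lookup q (i, i) = lookup m (i, i) \<Longrightarrow> (\<And>j. lookup q (j, j) \<le> lookup m (j, j))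
    \<Longrightarrow> lookup P q = lookup Q q"
  shows "lookup (L_op i P) m = lookup (L_op i Q) m"
proof -
  have eq: "lookup P (m - unit_expo k l + unit_expo i l + unit_expo k i)
      = lookup Q (m - unit_expo k l + unit_expo i l + unit_expo k i)" if "k \<noteq> i" "l \<noteq> i" for k l
    by (rule assms) (use that in \<open>auto simp: lookup_add lookup_minus lookup_single when_def\<close>)
  have "lookup (tvar k l * pderiv_t i l (pderiv_t k i P)) m
      = lookup (tvar k l * pderiv_t i l (pderiv_t k i Q)) m" if "k \<noteq> i" "l \<noteq> i" for k l
    by (simp only: lookup_tvar_times lookup_pderiv_t eq[OF that])
  then show ?thesis
    unfolding L_op_def lookup_sum by (intro sum.cong) auto
qed

lemma L_op_zero [simp]: "L_op i 0 = 0"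
  by (simp add: L_op_def)

lemma D_op_zero [simp]: "D_op \<kappa> i j 0 = 0"
  by (simp add: D_op_def)

lemma D_op_add: "D_op \<kappa> i j (P + Q) = D_op \<kappa> i j P + D_op \<kappa> i j Q"
  by (simp add: D_op_def pderiv_t_add tscale_add_right distrib_left sum.distrib)

lemma D_op_tscale: "D_op \<kappa> i j (tscale c P) = tscale c (D_op \<kappa> i j P)"
proof -
  have "tscale \<kappa> (tscale c (pderiv_t i j P)) = tscale c (tscale \<kappa> (pderiv_t i j P))"
    by (simp add: mult.commute)
  then show ?thesis
    by (simp only: D_op_def pderiv_t_tscale tscale_add_right tscale_sum tscale_times)
qed

lemma sum_row_unit_expo:
  "(\<Sum>j\<in>UNIV. lookup (unit_expo k l) (i, j)) = (if i = k then 1 else 0)" for k l :: "'n::finite"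
  by (auto simp: lookup_single when_def)

lemma sum_col_unit_expo:
  "(\<Sum>i\<in>UNIV. lookup (unit_expo k l) (i, j)) = (if j = l then 1 else 0)" for k l :: "'n::finite"
  by (auto simp: lookup_single when_def)

lemma has_degrees_le:
  assumes "has_degrees a b m"
  shows "lookup m (i, j) \<le> a i" and "lookup m (i, j) \<le> b j"
proof -
  have "lookup m (i, j) \<le> (\<Sum>j\<in>UNIV. lookup m (i, j))"
    by (rule member_le_sum) auto
  then show "lookup m (i, j) \<le> a i"
    using assms by (simp add: has_degrees_def)
  have "lookup m (i, j) \<le> (\<Sum>i\<in>UNIV. lookup m (i, j))"
    by (rule member_le_sum[of i UNIV "\<lambda>i. lookup m (i, j)"]) auto
  then show "lookup m (i, j) \<le> b j"
    using assms by (simp add: has_degrees_def)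
qed

text \<open>A term at \<open>m\<close> stems from \<open>m + unit_expo i i\<close> or, through
  \<open>L_op\<close>, from an exponent in which \<open>unit_expo k l + unit_expo i i\<close> is
  replaced by \<open>unit_expo i l + unit_expo k i\<close>. This exchange preserves all row and
  column sums.\<close>

lemma has_degrees_of_D_op:
  fixes P :: "'n::finite tpoly"
  assumes P: "P \<in> multihom a b" and nz: "lookup (D_op \<kappa> i i P) m \<noteq> 0"
  shows "has_degrees a b (m + unit_expo i i)"
proof (cases "lookup P (m + unit_expo i i) = 0")
  case False
  then show ?thesis using P by (simp add: multihom_iff)
next
  case True
  then have "lookup (L_op i P) m \<noteq> 0"
    using nz by (simp add: lookup_D_op[OF P])
  then have "(\<Sum>k\<in>-{i}. \<Sum>l\<in>-{i}. lookup (tvar k l * pderiv_t i l (pderiv_t k i P)) m) \<noteq> 0"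
    by (simp add: L_op_def lookup_sum)
  then obtain k l where "lookup (tvar k l * pderiv_t i l (pderiv_t k i P)) m \<noteq> 0"
    by (meson sum.neutral)
  then have kl: "lookup m (k, l) > 0"
    and "lookup P (m - unit_expo k l + unit_expo i l + unit_expo k i) \<noteq> 0"
    by (auto simp: lookup_tvar_times lookup_pderiv_t split: if_splits)
  then have "has_degrees a b (m - unit_expo k l + unit_expo i l + unit_expo k i)"
    using P by (simp add: multihom_iff)
  moreover have "has_degrees a b (n + unit_expo i l + unit_expo k i)
      \<longleftrightarrow> has_degrees a b (n + unit_expo k l + unit_expo i i)" for n
    by (simp only: has_degrees_def lookup_add sum.distrib sum_row_unit_expo sum_col_unit_expo add_ac)
  ultimately show ?thesis
    by (simp only: minus_unit_expo_add[OF kl])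
qed

text \<open>Truncated subtraction is harmless: a nonzero coefficient of the image forces
  \<open>a i\<close> and \<open>b i\<close> to be positive.\<close>

lemma D_op_multihom:
  fixes P :: "'n::finite tpoly"
  assumes P: "P \<in> multihom a b"
  shows "D_op \<kappa> i i P \<in> multihom (a(i := a i - 1)) (b(i := b i - 1))"
  unfolding multihom_iff
proof (intro allI impI)
  fix m
  assume "lookup (D_op \<kappa> i i P) m \<noteq> 0"
  then have "has_degrees a b (m + unit_expo i i)"
    by (rule has_degrees_of_D_op[OF P])
  then have "(\<Sum>j\<in>UNIV. lookup m (k, j)) + (if k = i then 1 else 0) = a k"
    "(\<Sum>j\<in>UNIV. lookup m (j, k)) + (if k = i then 1 else 0) = b k" for k
    by (simp_all only: has_degrees_def lookup_add sum.distrib sum_row_unit_expo sum_col_unit_expo)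
  note s = this
  show "has_degrees (a(i := a i - 1)) (b(i := b i - 1)) m"
    unfolding has_degrees_def by (simp flip: s)
qed

section \<open>Nonresonance and uniqueness of solutions\<close>

text \<open>These are the scalars of \<open>lookup_D_op\<close>. The exponent \<open>r + 1\<close>
  of the diagonal variable is at most \<open>min (a i) (b i)\<close>, whence the bound on
  \<open>r\<close>. Stated for one index, the condition is unaffected by lowering degrees at
  another.\<close>

definition nonresonant :: "complex \<Rightarrow> ('n \<Rightarrow> nat) \<Rightarrow> ('n \<Rightarrow> nat) \<Rightarrow> 'n \<Rightarrow> bool" where
  "nonresonant \<kappa> a b i \<longleftrightarrow>
     (\<forall>r < min (a i) (b i). \<kappa> + of_nat (a i) + of_nat (b i) - 2 - of_nat r \<noteq> 0)"

text \<open>A vanishing scalar means \<kappa> = r + 2 - a_i - b_i. As r runs from 0 to min(a_i, b_i)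
  - 1, this runs exactly through the \<open>i\<close>-th interval of \<open>Xi\<close>, because min
  + max = a_i + b_i.\<close>

lemma nonresonant_if_not_in_Xi:
  assumes "\<kappa> \<notin> of_int ` Xi a b"
  shows "nonresonant \<kappa> a b i"
  unfolding nonresonant_def
proof (intro allI impI notI)
  fix r
  assume r: "r < min (a i) (b i)"
    and "\<kappa> + of_nat (a i) + of_nat (b i) - 2 - of_nat r = 0"
  then have "\<kappa> = of_int (int r + 2 - int (a i) - int (b i))"
    by (simp add: algebra_simps)
  moreover have "int r + 2 - int (a i) - int (b i) \<in> Xi a b"
    using r unfolding Xi_def by (intro UN_I[of i]) auto
  ultimately show False using assms by blast
qed

text \<open>The equations \<open>D_op \<kappa> i i R = 0\<close> express a coefficient with a positive exponent of the \<open>i\<close>-th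
  diagonal variable through coefficients of smaller total degree in the diagonal variables.\<close>

lemma eq_zero_if_coeffs_zero:
  fixes R :: "'n::finite tpoly"
  assumes R: "R \<in> multihom a b"
    and nonres: "\<And>i. i \<in> S \<Longrightarrow> nonresonant \<kappa> a b i"
    and D: "\<And>i. i \<in> S \<Longrightarrow> D_op \<kappa> i i R = 0"
    and zero: "\<And>m. (\<And>i. i \<in> S \<Longrightarrow> lookup m (i, i) = 0) \<Longrightarrow> lookup R m = 0"
  shows "R = 0"
proof (rule poly_mapping_eqI)
  fix m
  show "lookup R m = lookup 0 m"
  proof (induction m rule: measure_induct_rule[where f = "\<lambda>m. \<Sum>i\<in>S. lookup m (i, i)"])
    case (less m)
    show ?case
    proof (cases "\<exists>i\<in>S. lookup m (i, i) > 0")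
      case True
      then obtain i where i: "i \<in> S" "lookup m (i, i) > 0" by blast
      define n where "n = m - unit_expo i i"
      have m: "m = n + unit_expo i i"
        using minus_unit_expo_add[OF i(2)] by (simp add: n_def)
      have sum_m: "(\<Sum>j\<in>S. lookup m (j, j)) = (\<Sum>j\<in>S. lookup n (j, j)) + 1"
        using i(1) by (simp add: m lookup_add lookup_single when_def sum.distrib)
      \<comment> \<open>\<open>L_op\<close> at \<open>n\<close> reads only exponents of diagonal
        degree at most that of \<open>n\<close>, which is one less than that of \<open>m\<close>;
        there \<open>R\<close> vanishes by induction.\<close>
      have "lookup (L_op i R) n = lookup (L_op i 0) n"
      proof (rule lookup_L_op_cong)
        fix q
        assume "\<And>j. lookup q (j, j) \<le> lookup n (j, j)"
        then have "(\<Sum>j\<in>S. lookup q (j, j)) < (\<Sum>j\<in>S. lookup m (j, j))"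
          unfolding sum_m by (simp add: less_Suc_eq_le sum_mono)
        then show "lookup R q = lookup 0 q" by (rule less)
      qed
      then have eq: "(\<kappa> + of_nat (a i) + of_nat (b i) - 2 - of_nat (lookup n (i, i)))
          * of_nat (Suc (lookup n (i, i))) * lookup R m = 0"
        using lookup_D_op[OF R, of \<kappa> i n] D[OF i(1)] by (simp add: m)
      show ?thesis
      proof (rule ccontr)
        assume nz: "lookup R m \<noteq> lookup 0 m"
        then have "has_degrees a b m"
          using R by (simp add: multihom_iff)
        then have "lookup n (i, i) < min (a i) (b i)"
          using has_degrees_le[of a b m i i] by (simp add: m lookup_add)
        then have "\<kappa> + of_nat (a i) + of_nat (b i) - 2 - of_nat (lookup n (i, i)) \<noteq> 0"
          using nonres[OF i(1)] by (simp add: nonresonant_def)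
        then show False
          using eq nz by (simp del: of_nat_Suc)
      qed
    next
      case False
      then show ?thesis using zero by simp
    qed
  qed
qed

section \<open>Existence of solutions with prescribed part free of diagonal variables\<close>

lemma multihom_add: "P \<in> multihom a b \<Longrightarrow> Q \<in> multihom a b \<Longrightarrow> P + Q \<in> multihom a b"
  by (auto simp: multihom_iff lookup_add) (metis add_0)

lemma multihom_tscale: "P \<in> multihom a b \<Longrightarrow> tscale c P \<in> multihom a b"
  by (simp add: multihom_iff lookup_tscale)

text \<open>The extension is built by increasing exponent \<open>r\<close> of the \<open>i\<close>-th diagonal variable: a term
  with exponent \<open>r + 1\<close> corrects the coefficients of \<^term>\<open>D_op \<kappa> i i Q\<close> with exponent \<open>r\<close>
  and leaves those with smaller exponent unchanged.\<close>

lemma ex_D_op_eq_zero_extension: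
  fixes P :: "'n::finite tpoly"
  assumes P: "P \<in> multihom a b" and nonres: "nonresonant \<kappa> a b i"
  shows "\<exists>Q\<in>multihom a b. D_op \<kappa> i i Q = 0 \<and> (\<forall>m. lookup m (i, i) = 0 \<longrightarrow> lookup Q m = lookup P m)"
proof -
  have "\<exists>Q\<in>multihom a b. (\<forall>m. lookup m (i, i) < r \<longrightarrow> lookup (D_op \<kappa> i i Q) m = 0)
      \<and> (\<forall>m. lookup m (i, i) = 0 \<longrightarrow> lookup Q m = lookup P m)" for r
  proof (induction r)
    case 0
    show ?case using P by auto
  next
    case (Suc r)
    then obtain Q where Q: "Q \<in> multihom a b"
      and DQ: "\<And>m. lookup m (i, i) < r \<Longrightarrow> lookup (D_op \<kappa> i i Q) m = 0"
      and QP: "\<And>m. lookup m (i, i) = 0 \<Longrightarrow> lookup Q m = lookup P m"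
      by blast
    define G where "G = D_op \<kappa> i i Q"
    define c where "c = (\<kappa> + of_nat (a i) + of_nat (b i) - 2 - of_nat r) * of_nat (Suc r)"
    \<comment> \<open>\<open>X\<close> is chosen so that its image cancels \<open>G\<close> at
      exponent \<open>r\<close>. If \<open>c = 0\<close>, division yields 0, which is right:
      nonresonance then forces \<open>G\<close> to vanish at exponent \<open>r\<close>.\<close>
    define X :: "'n tpoly" where "X = Abs_poly_mapping
      (\<lambda>m. if lookup m (i, i) = Suc r then - lookup G (m - unit_expo i i) / c else 0)"
    let ?f = "\<lambda>m. if lookup m (i, i) = Suc r then - lookup G (m - unit_expo i i) / c else 0"
    have "m \<in> (\<lambda>m. m + unit_expo i i) ` Poly_Mapping.keys G" if "?f m \<noteq> 0" for m
    proof (rule image_eqI)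
      show "m = m - unit_expo i i + unit_expo i i"
        using minus_unit_expo_add[of m i i] that by (auto split: if_splits)
      show "m - unit_expo i i \<in> Poly_Mapping.keys G"
        using that by (auto simp: in_keys_iff split: if_splits)
    qed
    then have "{m. ?f m \<noteq> 0} \<subseteq> (\<lambda>m. m + unit_expo i i) ` Poly_Mapping.keys G"
      by blast
    then have X: "lookup X m = ?f m" for m
      unfolding X_def by (subst lookup_Abs_poly_mapping) (rule finite_subset, assumption, simp_all)
    have "X \<in> multihom a b"
      unfolding multihom_iff
    proof (intro allI impI)
      fix m
      assume "lookup X m \<noteq> 0"
      then have m: "lookup m (i, i) > 0" and "lookup G (m - unit_expo i i) \<noteq> 0"
        by (auto simp: X split: if_splits)
      then have "has_degrees a b (m - unit_expo i i + unit_expo i i)"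
        unfolding G_def by (intro has_degrees_of_D_op[OF Q])
      then show "has_degrees a b m"
        by (simp only: minus_unit_expo_add[OF m])
    qed
    have "lookup (D_op \<kappa> i i (Q + X)) m = 0" if m: "lookup m (i, i) < Suc r" for m
    proof -
      \<comment> \<open>\<open>L_op\<close> preserves the exponent of the \<open>i\<close>-th
        diagonal variable, and \<open>X\<close> lives only at \<open>Suc r\<close>.\<close>
      have "lookup (L_op i X) m = lookup (L_op i 0) m"
        using m by (intro lookup_L_op_cong) (simp add: X)
      then have DX: "lookup (D_op \<kappa> i i X) m =
          (\<kappa> + of_nat (a i) + of_nat (b i) - 2 - of_nat (lookup m (i, i)))
          * of_nat (Suc (lookup m (i, i))) * lookup X (m + unit_expo i i)"
        by (simp add: lookup_D_op[OF \<open>X \<in> multihom a b\<close>])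
      show ?thesis
      proof (cases "lookup m (i, i) = r")
        case True
        then have "lookup (D_op \<kappa> i i X) m = c * (- lookup G m / c)"
          unfolding DX c_def[symmetric] by (simp add: X lookup_add c_def)
        moreover have "c \<noteq> 0" if "lookup G m \<noteq> 0"
        proof -
          have "has_degrees a b (m + unit_expo i i)"
            using that unfolding G_def by (rule has_degrees_of_D_op[OF Q])
          then have "r < min (a i) (b i)"
            using has_degrees_le[of a b "m + unit_expo i i" i i] True by (simp add: lookup_add)
          then show ?thesis
            using nonres by (simp add: c_def nonresonant_def del: of_nat_Suc)
        qed
        ultimately show ?thesis
          by (cases "lookup G m = 0") (simp_all add: D_op_add lookup_add G_def)
      next
        case False
        then have "lookup X (m + unit_expo i i) = 0"
          using m by (simp add: X lookup_add)
        then show ?thesis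
          using DX DQ[of m] False m by (simp add: D_op_add lookup_add)
      qed
    qed
    moreover have "lookup (Q + X) m = lookup P m" if "lookup m (i, i) = 0" for m
      using that by (simp add: lookup_add X QP)
    ultimately show ?case
      using multihom_add[OF Q \<open>X \<in> multihom a b\<close>] by blast
  qed
  \<comment> \<open>Taking \<open>r = a i\<close> suffices: any exponent \<open>m\<close> in the
    image satisfies \<open>lookup m (i, i) + 1 \<le> a i\<close>.\<close>
  then obtain Q where Q: "Q \<in> multihom a b"
    and DQ: "\<And>m. lookup m (i, i) < a i \<Longrightarrow> lookup (D_op \<kappa> i i Q) m = 0"
    and QP: "\<And>m. lookup m (i, i) = 0 \<Longrightarrow> lookup Q m = lookup P m"
    by meson
  have "lookup (D_op \<kappa> i i Q) m = 0" for m
  proof (rule ccontr)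
    assume nz: "lookup (D_op \<kappa> i i Q) m \<noteq> 0"
    have "lookup m (i, i) < a i"
      using has_degrees_le(1)[OF has_degrees_of_D_op[OF Q nz], of i i] by (simp add: lookup_add)
    then show False using DQ nz by blast
  qed
  then have "D_op \<kappa> i i Q = 0"
    by (simp add: poly_mapping_eqI)
  then show ?thesis using Q QP by blast
qed

text \<open>Extending along a further index \<open>j\<close> keeps the equations for \<open>i \<in> S\<close>: since the operators commute,
  \<^term>\<open>D_op \<kappa> i i\<close> of the extension is annihilated by \<^term>\<open>D_op \<kappa> j j\<close>, and it has no
  terms free of the \<open>j\<close>-th diagonal variable, so it vanishes.\<close>

lemma ex_D_ops_eq_zero_extension:
  fixes P :: "'n::finite tpoly" and S :: "'n set"
  assumes P: "P \<in> multihom a b" and nonres: "\<And>i. nonresonant \<kappa> a b i"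
  shows "\<exists>Q\<in>multihom a b. (\<forall>i\<in>S. D_op \<kappa> i i Q = 0)
    \<and> (\<forall>m. (\<forall>i\<in>S. lookup m (i, i) = 0) \<longrightarrow> lookup Q m = lookup P m)"
  using finite[of S]
proof (induction S)
  case empty
  show ?case using P by auto
next
  case (insert j S)
  then obtain Q1 where Q1: "Q1 \<in> multihom a b" and D1: "\<And>i. i \<in> S \<Longrightarrow> D_op \<kappa> i i Q1 = 0"
    and Q1P: "\<And>m. (\<And>i. i \<in> S \<Longrightarrow> lookup m (i, i) = 0) \<Longrightarrow> lookup Q1 m = lookup P m"
    by blast
  obtain Q2 where Q2: "Q2 \<in> multihom a b" and D2: "D_op \<kappa> j j Q2 = 0"
    and Q2Q1: "\<And>m. lookup m (j, j) = 0 \<Longrightarrow> lookup Q2 m = lookup Q1 m"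
    using ex_D_op_eq_zero_extension[OF Q1 nonres] by blast
  have "D_op \<kappa> i i Q2 = 0" if i: "i \<in> S" for i
  proof (rule eq_zero_if_coeffs_zero[OF D_op_multihom[OF Q2], of "{j}" \<kappa>])
    have ij: "i \<noteq> j" using i insert.hyps by auto
    show "nonresonant \<kappa> (a(i := a i - 1)) (b(i := b i - 1)) k" if "k \<in> {j}" for k
      using that ij nonres[of j] by (simp add: nonresonant_def)
    show "D_op \<kappa> k k (D_op \<kappa> i i Q2) = 0" if "k \<in> {j}" for k
      using that D2 by (simp add: D_op_commute[of \<kappa> j i])
    fix m :: "'n expo"
    assume "\<And>k. k \<in> {j} \<Longrightarrow> lookup m (k, k) = 0"
    then have m: "lookup m (j, j) = 0" by simp
    \<comment> \<open>At an \<open>m\<close> free of the \<open>j\<close>-th diagonal variable,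
      \<open>D_op \<kappa> i i\<close> reads only coefficients that are free of it too, where
      \<open>Q2\<close> agrees with \<open>Q1\<close>.\<close>
    have "lookup (L_op i Q2) m = lookup (L_op i Q1) m"
    proof (rule lookup_L_op_cong)
      fix q
      assume "\<And>j. lookup q (j, j) \<le> lookup m (j, j)"
      from this[of j] show "lookup Q2 q = lookup Q1 q" using m by (intro Q2Q1) simp
    qed
    moreover have "lookup Q2 (m + unit_expo i i) = lookup Q1 (m + unit_expo i i)"
      using m ij by (intro Q2Q1) (simp add: lookup_add lookup_single)
    ultimately have "lookup (D_op \<kappa> i i Q2) m = lookup (D_op \<kappa> i i Q1) m"
      by (simp only: lookup_D_op[OF Q1] lookup_D_op[OF Q2])
    then show "lookup (D_op \<kappa> i i Q2) m = 0"
      using D1[OF i] by simp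
  qed
  then show ?case
    using Q2 D2 Q2Q1 Q1P by (intro bexI[of _ Q2]) auto
qed

section \<open>The diagonal ideal and the projection\<close>

text \<open>The ideal is generated by variables, so membership can be tested monomial by monomial: a
  monomial belongs to it as soon as one diagonal variable divides it.\<close>

lemma diag_ideal_iff:
  fixes P :: "'n::finite tpoly"
  shows "P \<in> diag_ideal \<longleftrightarrow> (\<forall>m. (\<forall>i. lookup m (i, i) = 0) \<longrightarrow> lookup P m = 0)"
proof
  assume "P \<in> diag_ideal"
  then show "\<forall>m. (\<forall>i. lookup m (i, i) = 0) \<longrightarrow> lookup P m = 0"
    unfolding diag_ideal_def
  proof (induction rule: tpoly_ring.span_induct_alt)
    case base
    show ?case by simp
  next
    case (step c x y)
    then obtain i where "x = tvar i i" by blast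
    then show ?case
      using step by (simp add: lookup_add mult.commute[of c] lookup_tvar_times)
  qed
next
  assume zero: "\<forall>m. (\<forall>i. lookup m (i, i) = 0) \<longrightarrow> lookup P m = 0"
  have "P = (\<Sum>m\<in>Poly_Mapping.keys P. Poly_Mapping.single m (lookup P m))"
    by (rule poly_mapping_eqI) (auto simp: lookup_sum lookup_single when_def in_keys_iff)
  also have "\<dots> \<in> diag_ideal"
    unfolding diag_ideal_def
  proof (rule tpoly_ring.span_sum)
    fix m
    assume "m \<in> Poly_Mapping.keys P"
    then obtain i where "lookup m (i, i) > 0"
      using zero by (auto simp: in_keys_iff)
    then have "Poly_Mapping.single m (lookup P m)
        = Poly_Mapping.single (m - unit_expo i i) (lookup P m) * tvar i i"
      using minus_unit_expo_add[of m i i] by (simp add: tvar_def mult_single)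
    moreover have "Poly_Mapping.single (m - unit_expo i i) (lookup P m) * tvar i i
        \<in> tpoly_ring.span (range (\<lambda>i. tvar i i))"
      by (rule tpoly_ring.span_scale[OF tpoly_ring.span_base[OF rangeI]])
    ultimately show "Poly_Mapping.single m (lookup P m) \<in> tpoly_ring.span (range (\<lambda>i. tvar i i))"
      by (simp only:)
  qed
  finally show "P \<in> diag_ideal" .
qed

lemma P_space_add: "P \<in> P_space a b \<kappa> \<Longrightarrow> Q \<in> P_space a b \<kappa> \<Longrightarrow> P + Q \<in> P_space a b \<kappa>"
  by (simp add: P_space_def multihom_add D_op_add)

lemma P_space_tscale: "P \<in> P_space a b \<kappa> \<Longrightarrow> tscale c P \<in> P_space a b \<kappa>"
  by (simp add: P_space_def multihom_tscale D_op_tscale)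

lemma subspace_P_space: "tpoly.subspace (P_space a b \<kappa>)"
  by (rule tpoly.subspaceI) (simp_all add: P_space_add P_space_tscale, simp add: P_space_def multihom_def)

text \<open>Injectivity of reduction modulo the diagonal variables:
  \<open>eq_zero_if_coeffs_zero\<close> for the difference, with all indices in
  \<open>S\<close>.\<close>

lemma P_space_eqI:
  fixes P Q :: "'n::finite tpoly"
  assumes P: "P \<in> P_space a b \<kappa>" and Q: "Q \<in> P_space a b \<kappa>"
    and nonres: "\<And>i. nonresonant \<kappa> a b i"
    and eq: "\<And>m. (\<And>i. lookup m (i, i) = 0) \<Longrightarrow> lookup P m = lookup Q m"
  shows "P = Q"
proof -
  have "P - Q \<in> P_space a b \<kappa>"
    using subspace_P_space P Q by (rule tpoly.subspace_diff)
  then have "P - Q = 0"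
    using nonres eq
    by (intro eq_zero_if_coeffs_zero[of "P - Q" a b UNIV \<kappa>]) (simp_all add: P_space_def lookup_minus)
  then show ?thesis by simp
qed

text \<open>Extension gives existence and \<open>P_space_eqI\<close> gives uniqueness, so the
  definite description in \<open>Pi_proj\<close> denotes the intended polynomial.\<close>

lemma Pi_proj:
  fixes P :: "'n::finite tpoly"
  assumes P: "P \<in> multihom a b" and nonres: "\<And>i. nonresonant \<kappa> a b i"
  shows "Pi_proj a b \<kappa> P \<in> P_space a b \<kappa>"
    and "(\<And>i. lookup m (i, i) = 0) \<Longrightarrow> lookup (Pi_proj a b \<kappa> P) m = lookup P m"
proof -
  have cong: "Q - P \<in> diag_ideal \<longleftrightarrow> (\<forall>m. (\<forall>i. lookup m (i, i) = 0) \<longrightarrow> lookup Q m = lookup P m)"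
    for Q :: "'n tpoly"
    by (simp add: diag_ideal_iff lookup_minus)
  have "\<exists>!Q. Q \<in> P_space a b \<kappa> \<and> Q - P \<in> diag_ideal"
  proof (rule ex_ex1I)
    show "\<exists>Q. Q \<in> P_space a b \<kappa> \<and> Q - P \<in> diag_ideal"
      using ex_D_ops_eq_zero_extension[OF P nonres, of UNIV] by (auto simp: cong P_space_def)
    show "Q = R" if "Q \<in> P_space a b \<kappa> \<and> Q - P \<in> diag_ideal"
      "R \<in> P_space a b \<kappa> \<and> R - P \<in> diag_ideal" for Q R
      using that by (intro P_space_eqI[OF _ _ nonres]) (auto simp: cong)
  qed
  from theI'[OF this] have "Pi_proj a b \<kappa> P \<in> P_space a b \<kappa> \<and> Pi_proj a b \<kappa> P - P \<in> diag_ideal"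
    by (simp add: Pi_proj_def)
  then show "Pi_proj a b \<kappa> P \<in> P_space a b \<kappa>"
    and "(\<And>i. lookup m (i, i) = 0) \<Longrightarrow> lookup (Pi_proj a b \<kappa> P) m = lookup P m"
    by (auto simp: cong)
qed

section \<open>Monomials and the basis property\<close>

text \<open>Written as a double sum because this is the exponent that multiplying out
  \<open>tmonom\<close> produces.\<close>

definition expo_of :: "('n::finite \<Rightarrow> 'n \<Rightarrow> nat) \<Rightarrow> 'n expo" where
  "expo_of \<nu> = (\<Sum>i\<in>UNIV. \<Sum>j\<in>UNIV. Poly_Mapping.single (i, j) (\<nu> i j))"

lemma lookup_expo_of [simp]: "lookup (expo_of \<nu>) (i, j) = \<nu> i j"
proof -
  have "lookup (expo_of \<nu>) (i, j)
      = (\<Sum>x\<in>UNIV. if (fst x, snd x) = (i, j) then \<nu> (fst x) (snd x) else 0)"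
    unfolding expo_of_def lookup_sum lookup_single when_def by (rule sum_UNIV_UNIV)
  also have "\<dots> = \<nu> i j"
    by (simp only: prod.collapse) simp
  finally show ?thesis .
qed

lemma expo_of_eq_iff [simp]: "expo_of \<mu> = expo_of \<nu> \<longleftrightarrow> \<mu> = \<nu>"
  by (metis ext lookup_expo_of)

lemma expo_of_lookup: "expo_of (\<lambda>i j. lookup m (i, j)) = m"
  by (rule poly_mapping_eqI) (auto simp: split_paired_all)

lemma prod_single_one:
  "(\<Prod>x\<in>A. Poly_Mapping.single (f x) (1 :: complex)) = Poly_Mapping.single (\<Sum>x\<in>A. f x) 1"
  by (induction A rule: infinite_finite_induct) (simp_all add: mult_single)

lemma tvar_power: "tvar i j ^ k = Poly_Mapping.single (Poly_Mapping.single (i, j) k) 1"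
  by (induction k) (simp_all add: tvar_def mult_single flip: single_add)

lemma tmonom_eq_single: "tmonom \<nu> = Poly_Mapping.single (expo_of \<nu>) 1"
  by (simp only: tmonom_def tvar_power prod_single_one expo_of_def)

lemma N0_iff: "\<nu> \<in> N0 a b \<longleftrightarrow> has_degrees a b (expo_of \<nu>) \<and> (\<forall>i. \<nu> i i = 0)"
  by (auto simp: N0_def has_degrees_def)

lemma finite_N0: "finite (N0 a b)" for a b :: "'n::finite \<Rightarrow> nat"
proof (rule finite_subset)
  show "N0 a b \<subseteq> (\<Pi>\<^sub>E i\<in>UNIV. \<Pi>\<^sub>E j\<in>UNIV. {..a i})"
  proof
    fix \<nu>
    assume "\<nu> \<in> N0 a b"
    then have "\<nu> i j \<le> a i" for i j
      using has_degrees_le(1)[of a b "expo_of \<nu>" i j] by (simp add: N0_iff)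
    then show "\<nu> \<in> (\<Pi>\<^sub>E i\<in>UNIV. \<Pi>\<^sub>E j\<in>UNIV. {..a i})"
      by (simp add: PiE_iff)
  qed
qed (simp add: finite_PiE)

theorem mainTheorem4:
  fixes a b :: "'n::finite \<Rightarrow> nat" and \<kappa> :: complex
  assumes "\<kappa> \<notin> of_int ` Xi a b"
  shows "basis_family (P_M a b \<kappa>) (N0 a b) (P_space a b \<kappa>)"
proof -
  have nonres: "nonresonant \<kappa> a b i" for i
    using assms by (rule nonresonant_if_not_in_Xi)
  have tmonom: "tmonom \<nu> \<in> multihom a b" if "\<nu> \<in> N0 a b" for \<nu>
    using that by (auto simp: multihom_iff tmonom_eq_single lookup_single when_def N0_iff)
  have P_M: "P_M a b \<kappa> \<nu> \<in> P_space a b \<kappa>" if "\<nu> \<in> N0 a b" for \<nu>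
    unfolding P_M_def using tmonom[OF that] nonres by (rule Pi_proj)
  \<comment> \<open>On the exponents from \<open>N0 a b\<close> the family has the identity as its
    coefficient matrix; injectivity, independence and the expansion of an arbitrary solution all
    rest on this.\<close>
  have coeff: "lookup (P_M a b \<kappa> \<nu>) (expo_of \<mu>) = (if \<nu> = \<mu> then 1 else 0)"
    if "\<nu> \<in> N0 a b" "\<mu> \<in> N0 a b" for \<mu> \<nu>
    using Pi_proj(2)[OF tmonom[OF that(1)] nonres, of "expo_of \<mu>"] that(2)
    by (simp add: P_M_def tmonom_eq_single lookup_single when_def N0_iff)
  have coeff_sum: "lookup (\<Sum>\<nu>\<in>N0 a b. tscale (c \<nu>) (P_M a b \<kappa> \<nu>)) (expo_of \<mu>) = c \<mu>"
    if "\<mu> \<in> N0 a b" for c \<mu>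
  proof -
    have "lookup (\<Sum>\<nu>\<in>N0 a b. tscale (c \<nu>) (P_M a b \<kappa> \<nu>)) (expo_of \<mu>)
        = (\<Sum>\<nu>\<in>N0 a b. if \<nu> = \<mu> then c \<nu> else 0)"
      unfolding lookup_sum lookup_tscale by (rule sum.cong) (simp_all add: coeff that)
    then show ?thesis
      using that by (simp add: finite_N0)
  qed
  have inj: "inj_on (P_M a b \<kappa>) (N0 a b)"
  proof (rule inj_onI)
    fix \<mu> \<nu>
    assume "\<mu> \<in> N0 a b" "\<nu> \<in> N0 a b" "P_M a b \<kappa> \<mu> = P_M a b \<kappa> \<nu>"
    then show "\<mu> = \<nu>"
      using coeff[of \<mu> \<nu>] coeff[of \<nu> \<nu>] by (auto split: if_splits)
  qed
  have "tpoly.independent (P_M a b \<kappa> ` N0 a b)"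
  proof (rule tpoly.independent_if_scalars_zero)
    show "finite (P_M a b \<kappa> ` N0 a b)" by (simp add: finite_N0)
    fix f x
    assume "(\<Sum>x\<in>P_M a b \<kappa> ` N0 a b. tscale (f x) x) = 0" "x \<in> P_M a b \<kappa> ` N0 a b"
    then show "f x = 0"
      using coeff_sum[of _ "\<lambda>\<nu>. f (P_M a b \<kappa> \<nu>)"] by (auto simp: sum.reindex[OF inj])
  qed
  moreover have "tpoly.span (P_M a b \<kappa> ` N0 a b) = P_space a b \<kappa>"
  proof
    show "tpoly.span (P_M a b \<kappa> ` N0 a b) \<subseteq> P_space a b \<kappa>"
      using P_M by (intro tpoly.span_minimal subspace_P_space) auto
    show "P_space a b \<kappa> \<subseteq> tpoly.span (P_M a b \<kappa> ` N0 a b)"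
    proof
      fix P
      assume P: "P \<in> P_space a b \<kappa>"
      \<comment> \<open>If \<open>P\<close> is a combination of the family, \<open>coeff_sum\<close>
        leaves only these coefficients. \<open>P\<close> and \<open>Q\<close> are both solutions, so
        it suffices to compare them at exponents with zero diagonal.\<close>
      define Q where "Q = (\<Sum>\<nu>\<in>N0 a b. tscale (lookup P (expo_of \<nu>)) (P_M a b \<kappa> \<nu>))"
      have Q: "Q \<in> P_space a b \<kappa>"
        unfolding Q_def by (intro tpoly.subspace_sum[OF subspace_P_space] P_space_tscale P_M)
      have "P = Q"
      proof (rule P_space_eqI[OF P Q nonres])
        fix m :: "'n expo"
        assume diag: "\<And>i. lookup m (i, i) = 0"
        define \<mu> where "\<mu> = (\<lambda>i j. lookup m (i, j))"
        have m: "m = expo_of \<mu>"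
          by (simp add: \<mu>_def expo_of_lookup)
        show "lookup P m = lookup Q m"
        proof (cases "has_degrees a b m")
          case True
          then have "\<mu> \<in> N0 a b"
            using diag by (simp add: N0_iff m)
          then show ?thesis
            unfolding m Q_def by (rule coeff_sum[symmetric])
        next
          case False
          then have "lookup P m = 0" "lookup Q m = 0"
            using P Q by (auto simp: P_space_def multihom_iff)
          then show ?thesis by simp
        qed
      qed
      also have "Q \<in> tpoly.span (P_M a b \<kappa> ` N0 a b)"
        unfolding Q_def by (intro tpoly.span_sum tpoly.span_scale tpoly.span_base) auto
      finally show "P \<in> tpoly.span (P_M a b \<kappa> ` N0 a b)" .
    qed
  qed
  ultimately show ?thesis
    using inj by (simp add: basis_family_def)
qed

end
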